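(* Let $m\ge2$ and let $C=(c_{jk})$ be an $m\times m$ cost matrix. For any $\eta,q\in\Delta_m$, $$B^{\mathrm{cw}}(\eta,\overline C^{T}q)\le\|\overline C^{T}(\eta-q)\|_{\infty2},$$ where $\overline C=C_M1_m^{T}-C$ and $C_M=(c_{1M},\ldots,c_{mM})^{T}$ with $c_{jM}=\max_{k}c_{jk}$ for $j\in\{1,\ldots,m\}$.
   Context: $\Delta_m=\{q\in\mathbb R^m: q_j\ge0,\ \sum_jq_j=1\}$; $1_m$ is the all-ones vector; $\|b\|_{\infty2}=\max_{j\ne k}(|b_j|+|b_k|)$ for $b\in\mathbb R^m$. A cost matrix $C=(C_1,\ldots,C_m)$ (columns $C_k$) has $c_{jk}\ge0$, $c_{jj}=0$, and for each $j$, $c_{jk}>0$ for some $k\ne j$. The cost-weighted classification loss is $L^{\mathrm{cw}}(j,\gamma)=c_{jk}$ if $k=\mathrm{argmax}_l\gamma_l$, $\gamma\in\mathbb R^m$ (argmax is a single index of a maximum component, ties broken by any fixed rule). Its regret is $B^{\mathrm{cw}}(\eta,\gamma)=\sum_j\eta_jL^{\mathrm{cw}}(j,\gamma)-\min_k\eta^{T}C_k$. *)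

theory Defs
  imports "HOL-Analysis.Analysis"
begin

definition prob_simplex :: "(real ^ 'm::finite) set" where
  "prob_simplex = {q. (\<forall>j. 0 \<le> q $ j) \<and> (\<Sum>j\<in>UNIV. q $ j) = 1}"

(* Max is unspecified on the empty set: meaningful only for dimension at least 2. *)
definition norm_inf2 :: "real ^ 'm::finite \<Rightarrow> real" where
  "norm_inf2 b = Max {\<bar>b $ j\<bar> + \<bar>b $ k\<bar> | j k. j \<noteq> k}"

(* C $ j $ k is the cost of predicting class k when the true class is j. *)
definition cost_matrix :: "real ^ 'm ^ 'm::finite \<Rightarrow> bool" where
  "cost_matrix C \<longleftrightarrow>
     (\<forall>j k. 0 \<le> C $ j $ k) \<and> (\<forall>j. C $ j $ j = 0) \<and> (\<forall>j. \<exists>k. k \<noteq> j \<and> 0 < C $ j $ k)"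

(* A single-valued argmax with a fixed but arbitrary rule for breaking ties,
   which may depend on the vector. *)
definition argmax_rule :: "(real ^ 'm::finite \<Rightarrow> 'm) \<Rightarrow> bool" where
  "argmax_rule am \<longleftrightarrow> (\<forall>\<gamma> l. \<gamma> $ l \<le> \<gamma> $ am \<gamma>)"

definition loss_cw ::
  "(real ^ 'm::finite \<Rightarrow> 'm) \<Rightarrow> real ^ 'm ^ 'm \<Rightarrow> 'm \<Rightarrow> real ^ 'm \<Rightarrow> real" where
  "loss_cw am C j \<gamma> = C $ j $ am \<gamma>"

definition regret_cw ::
  "(real ^ 'm::finite \<Rightarrow> 'm) \<Rightarrow> real ^ 'm ^ 'm \<Rightarrow> real ^ 'm \<Rightarrow> real ^ 'm \<Rightarrow> real" where
  "regret_cw am C \<eta> \<gamma> =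
     (\<Sum>j\<in>UNIV. \<eta> $ j * loss_cw am C j \<gamma>) - Min (range (\<lambda>k. \<eta> \<bullet> column k C))"

definition row_max :: "real ^ 'm ^ 'm::finite \<Rightarrow> real ^ 'm" where
  "row_max C = (\<chi> j. Max (range (\<lambda>k. C $ j $ k)))"

definition outer_prod :: "real ^ 'm::finite \<Rightarrow> real ^ 'm \<Rightarrow> real ^ 'm ^ 'm" where
  "outer_prod u v = (\<chi> j k. u $ j * v $ k)"

definition complement_cost :: "real ^ 'm ^ 'm::finite \<Rightarrow> real ^ 'm ^ 'm" where
  "complement_cost C = outer_prod (row_max C) (vec 1) - C"

end

theory Submission
  imports Defs
begin

text \<open>
  Component \<open>k\<close> of \<open>transpose (complement_cost C) *v x\<close> is \<open>x \<bullet> row_max C - x \<bullet> column k C\<close>, and the first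
  term does not depend on \<open>k\<close>. Hence, if \<open>k\<close> minimises the expected cost and \<open>l\<close> is the predicted
  class, the regret is the difference of components \<open>k\<close> and \<open>l\<close> at \<open>\<eta>\<close>. The corresponding
  difference at \<open>q\<close> is nonpositive since \<open>l\<close> maximises the score, so subtracting it only
  increases the bound.
\<close>

lemma transpose_complement_cost_mult:
  "(transpose (complement_cost C) *v x) $ k = x \<bullet> row_max C - x \<bullet> column k C"
  by (simp add: matrix_vector_mult_def transpose_def complement_cost_def outer_prod_def
      inner_vec_def column_def algebra_simps sum_subtractf)

lemma abs_add_abs_le_norm_inf2:
  assumes "j \<noteq> k"
  shows "\<bar>b $ j\<bar> + \<bar>b $ k\<bar> \<le> norm_inf2 b"
proof -
  \<comment> \<open>\<open>Max_ge\<close> needs a finite set; finiteness is inherited from the image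
    of all index pairs.\<close>
  have "{\<bar>b $ j\<bar> + \<bar>b $ k\<bar> | j k. j \<noteq> k} \<subseteq> range (\<lambda>(j, k). \<bar>b $ j\<bar> + \<bar>b $ k\<bar>)"
    by auto
  then have "finite {\<bar>b $ j\<bar> + \<bar>b $ k\<bar> | j k. j \<noteq> k}"
    by (rule finite_subset) simp
  then show ?thesis
    unfolding norm_inf2_def using assms by (intro Max_ge) auto
qed

lemma norm_inf2_nonneg:
  fixes b :: "real ^ 'm::finite"
  assumes "CARD('m) \<ge> 2"
  shows "0 \<le> norm_inf2 b"
proof -
  obtain j k :: 'm where "j \<noteq> k"
    using assms card_2_iff' ex_card[of 2 "UNIV :: 'm set"] by metis
  from abs_add_abs_le_norm_inf2[OF this, of b] show ?thesis
    by linarith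
qed

text \<open>Distinct indices need only the triangle inequality. The case \<open>k = l\<close>, which
  arises when the predicted class already minimises the expected cost, is not among the pairs in
  \<open>norm_inf2\<close> and rests on its nonnegativity.\<close>

lemma diff_le_norm_inf2:
  fixes b :: "real ^ 'm::finite"
  assumes "CARD('m) \<ge> 2"
  shows "b $ k - b $ l \<le> norm_inf2 b"
proof (cases "k = l")
  case True
  then show ?thesis
    using norm_inf2_nonneg[OF assms] by simp
next
  case False
  from abs_add_abs_le_norm_inf2[OF this, of b] show ?thesis
    by linarith
qed

theorem lemma6:
  fixes C :: "real ^ 'm ^ 'm::finite"
    and am :: "real ^ 'm \<Rightarrow> 'm"
    and \<eta> q :: "real ^ 'm"
  assumes "CARD('m) \<ge> 2"
    and "cost_matrix C"
    and "argmax_rule am"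
    and "\<eta> \<in> prob_simplex"
    and "q \<in> prob_simplex"
  shows "regret_cw am C \<eta> (transpose (complement_cost C) *v q)
           \<le> norm_inf2 (transpose (complement_cost C) *v (\<eta> - q))"
proof -
  let ?G = "\<lambda>x. transpose (complement_cost C) *v x"
  define l where "l = am (?G q)"
  have "Min (range (\<lambda>k. \<eta> \<bullet> column k C)) \<in> range (\<lambda>k. \<eta> \<bullet> column k C)"
    by (intro Min_in) auto
  then obtain k where k: "Min (range (\<lambda>k. \<eta> \<bullet> column k C)) = \<eta> \<bullet> column k C"
    by blast
  have "regret_cw am C \<eta> (?G q) = \<eta> \<bullet> column l C - \<eta> \<bullet> column k C"
    unfolding regret_cw_def k by (simp add: loss_cw_def l_def inner_vec_def column_def)
  also have "\<dots> = ?G \<eta> $ k - ?G \<eta> $ l"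
    unfolding transpose_complement_cost_mult by simp
  \<comment> \<open>By linearity of \<open>?G\<close> the gain is
    \<open>?G q $ l - ?G q $ k\<close>.\<close>
  also have "\<dots> \<le> ?G (\<eta> - q) $ k - ?G (\<eta> - q) $ l"
    using assms(3) unfolding argmax_rule_def l_def matrix_vector_mult_diff_distrib by simp
  also have "\<dots> \<le> norm_inf2 (?G (\<eta> - q))"
    using assms(1) by (rule diff_le_norm_inf2)
  finally show ?thesis .
qed

end
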